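(* Let $p$ be a prime number and let $F(x)\in\mathbb{F}_p[[x]]$ be a power series satisfying $$A(x)+B(x)F(x)+C(x)F(x)^2=0,$$ where $A(x),B(x),C(x)\in\mathbb{F}_p[x]$ satisfy one of the following conditions: (i) $B(0)=1$, $C(0)=0$, $C(x)\neq 0$; (ii) $B(0)=1$, $C(x)=0$; (iii) $B(0)=1$, $C(0)\neq 0$, $A(0)=0$; (iv) $p\neq 2$, $B(x)=0$, $C(0)=1$, and $A(x)=-(a_kx^k)^2+O(x^{2k+1})$ for some $k\in\mathbb{N}$ and some $a_k\neq 0$. Then the Hankel continued fraction expansion of $F(x)$ exists and is ultimately periodic. Moreover, the Hankel determinant sequence $H(F)$ is ultimately periodic.
   Context: $\mathbb{F}_p=\mathbb{Z}/p\mathbb{Z}$. For a power series $f=\sum_{i\ge0}a_ix^i$ over a field and $n\ge1$, the Hankel determinant is $H_n(f)=\det(a_{i+j})_{0\le i,j\le n-1}$, with $H_0(f)=1$, and $H(f)=(H_0(f),H_1(f),H_2(f),\dots)$. A Hankel continued fraction (H-fraction) is a continued fraction of the form $$F(x)=\cfrac{v_0x^{k_0}}{1+u_1(x)x-\cfrac{v_1x^{k_0+k_1+2}}{1+u_2(x)x-\cfrac{v_2x^{k_1+k_2+2}}{1+u_3(x)x-\cdots}}}$$ where the $v_j$ are nonzero constants of the field, the $k_j$ are nonnegative integers, and each $u_j(x)$ is a polynomial of degree at most $k_{j-1}$ (the zero polynomial has degree $-1$); the expansion may terminate after finitely many levels (the zero series has the empty expansion). The H-fraction is ultimately periodic if the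 sequence of data $(v_j,k_j,u_{j+1}(x))_{j\ge0}$ is ultimately periodic; a terminating expansion is regarded as ultimately periodic. A sequence is ultimately periodic if it is periodic from some index on. *)

theory Defs
  imports
    "Berlekamp_Zassenhaus.Finite_Field"
    "Jordan_Normal_Form.Determinant"
    "HOL-Computational_Algebra.Polynomial_FPS"
begin

definition ultimately_periodic :: "(nat \<Rightarrow> 'b) \<Rightarrow> bool" where
  "ultimately_periodic s \<longleftrightarrow> (\<exists>N. \<exists>T>0. \<forall>n\<ge>N. s (n + T) = s n)"

text \<open>The \<open>0 \<times> 0\<close> determinant is 1, so the convention for \<open>n = 0\<close> needs no separate clause.\<close>

definition hankel_det :: "'a::field fps \<Rightarrow> nat \<Rightarrow> 'a" where
  "hankel_det f n = Determinant.det (Matrix.mat n n (\<lambda>(i, j). fps_nth f (i + j)))"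

text \<open>Level \<open>j\<close> of an H-fraction carries the triple \<open>(v\<^sub>j, k\<^sub>j, u\<^sub>j\<^sub>+\<^sub>1)\<close>.\<close>

type_synonym 'a hlevel = "'a \<times> nat \<times> 'a poly"

text \<open>The convention that the zero polynomial has degree \<open>-1\<close> instead of 0 makes no difference
  to the degree bound, since \<open>k \<ge> 0\<close>.\<close>

definition valid_hlevel :: "'a::field hlevel \<Rightarrow> bool" where
  "valid_hlevel = (\<lambda>(v, k, u). v \<noteq> 0 \<and> Polynomial.degree u \<le> k)"

text \<open>In \<open>hfrac_below k ds\<close>, the argument \<open>k\<close> is the exponent of the level directly above \<open>ds\<close>.
  All denominators have constant term 1, so the divisions are by units.\<close>

fun hfrac_below :: "nat \<Rightarrow> 'a::field hlevel list \<Rightarrow> 'a fps" where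
  "hfrac_below k [] = 0"
| "hfrac_below k ((v, l, u) # ds) =
     (fps_const v * fps_X ^ (k + l + 2)) / (1 + fps_of_poly u * fps_X - hfrac_below l ds)"

fun hfrac_value :: "'a::field hlevel list \<Rightarrow> 'a fps" where
  "hfrac_value [] = 0"
| "hfrac_value ((v, k, u) # ds) =
     (fps_const v * fps_X ^ k) / (1 + fps_of_poly u * fps_X - hfrac_below k ds)"

datatype 'd expansion = Terminating "'d list" | Infinite "nat \<Rightarrow> 'd"

type_synonym 'a hfraction = "'a hlevel expansion"

text \<open>An infinite H-fraction is the limit of its convergents in the \<open>x\<close>-adic topology, which is the
  topology of the metric space instance of \<^typ>\<open>'a fps\<close>.\<close>

fun is_hfraction_of :: "'a::field hfraction \<Rightarrow> 'a fps \<Rightarrow> bool" where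
  "is_hfraction_of (Terminating ds) F \<longleftrightarrow>
     (\<forall>d\<in>set ds. valid_hlevel d) \<and> hfrac_value ds = F"
| "is_hfraction_of (Infinite d) F \<longleftrightarrow>
     (\<forall>j. valid_hlevel (d j)) \<and> (\<lambda>n. hfrac_value (map d [0..<n])) \<longlonglongrightarrow> F"

fun hfraction_ultimately_periodic :: "'a::field hfraction \<Rightarrow> bool" where
  "hfraction_ultimately_periodic (Terminating ds) \<longleftrightarrow> True"
| "hfraction_ultimately_periodic (Infinite d) \<longleftrightarrow> ultimately_periodic d"

end

theory Submission
  imports Defs
begin

text \<open>
  Write \<open>F = v x\<^sup>k / (P - x\<^sup>k\<^sup>+\<^sup>2 G)\<close> with \<open>P = 1 + u x\<close>; every nonzero series has exactly one such
  form, and iterating \<open>F \<mapsto> G\<close> produces the H-fraction. If \<open>A + B F + C F\<^sup>2 = 0\<close> with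
  \<open>B(0) \<noteq> 0\<close> and \<open>C(0) = 0\<close>, then \<open>G\<close> satisfies an equation of the same kind, and the degree bounds
  \<open>N\<close>, \<open>N + 1\<close>, \<open>N + 2\<close> for \<open>A\<close>, \<open>B\<close>, \<open>C\<close> are inherited; in all four cases of the theorem the first
  tail has such an equation. Over a finite field only finitely many series are roots of these
  equations, so two tails of an infinite expansion coincide and the expansion is periodic from there on.

  For the determinants, conjugating the Hankel matrix of \<open>F\<close> by the unipotent Toeplitz matrix of
  \<open>D = P - x\<^sup>k\<^sup>+\<^sup>2 G\<close> makes it block diagonal, whence
  \<open>H\<^sub>n\<^sub>+\<^sub>k\<^sub>+\<^sub>1(F) = c v\<^sup>n H\<^sub>n(G)\<close> with \<open>c\<close> depending only on the level \<open>(v, k, u)\<close>. A tail that recurs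
  after \<open>s\<close> rows therefore satisfies \<open>H\<^sub>n\<^sub>+\<^sub>s = K w\<^sup>n H\<^sub>n\<close>, which forces periodicity in a finite field.
\<close>

section \<open>Levels of an H-fraction\<close>

text \<open>One level over an arbitrary tail. The factor \<open>x^(k+2)\<close> is split off from
  the tail, so that a level does not depend on its neighbours and an H-fraction becomes a right
  fold.\<close>

definition hfrac_cons :: "'a::field hlevel \<Rightarrow> 'a fps \<Rightarrow> 'a fps" where
  "hfrac_cons = (\<lambda>(v, k, u) G.
     (fps_const v * fps_X ^ k) / (1 + fps_of_poly u * fps_X - fps_X ^ (k + 2) * G))"

lemma fps_X_power_dvd_iff:
  "fps_X ^ n dvd (f :: 'a::field fps) \<longleftrightarrow> (\<forall>i<n. fps_nth f i = 0)"
proof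
  assume "\<forall>i<n. fps_nth f i = 0"
  then have "f = fps_X ^ n * fps_shift n f"
    by (auto simp: fps_eq_iff fps_X_power_mult_nth)
  then show "fps_X ^ n dvd f"
    by (metis dvd_triv_left)
qed (auto simp: fps_X_power_mult_nth)

lemma tendsto_fps_iff_dvd:
  "(f \<longlonglongrightarrow> (g :: 'a::field fps)) \<longleftrightarrow> (\<forall>m. eventually (\<lambda>n. fps_X ^ m dvd f n - g) sequentially)"
proof
  assume f: "f \<longlonglongrightarrow> g"
  show "\<forall>m. eventually (\<lambda>n. fps_X ^ m dvd f n - g) sequentially"
  proof
    fix m
    have "eventually (\<lambda>n. \<forall>i\<in>{..<m}. fps_nth (f n) i = fps_nth g i) sequentially"
      using f by (subst eventually_ball_finite_distrib) (auto simp: tendsto_fps_iff)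
    then show "eventually (\<lambda>n. fps_X ^ m dvd f n - g) sequentially"
      by eventually_elim (auto simp: fps_X_power_dvd_iff)
  qed
next
  assume *: "\<forall>m. eventually (\<lambda>n. fps_X ^ m dvd f n - g) sequentially"
  show "f \<longlonglongrightarrow> g"
  proof (rule tendsto_fpsI)
    fix i
    from * have "eventually (\<lambda>n. fps_X ^ Suc i dvd f n - g) sequentially"
      by blast
    then show "eventually (\<lambda>n. fps_nth (f n) i = fps_nth g i) sequentially"
      by eventually_elim (simp only: fps_X_power_dvd_iff, auto)
  qed
qed

lemma hfrac_cons_mult:
  "hfrac_cons (v, k, u) G * (1 + fps_of_poly u * fps_X - fps_X ^ (k + 2) * G)
     = fps_const v * fps_X ^ k"
proof -
  let ?D = "1 + fps_of_poly u * fps_X - fps_X ^ (k + 2) * G"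
  have "fps_nth ?D 0 = 1" by simp
  then have "inverse ?D * ?D = 1" and "hfrac_cons (v, k, u) G = fps_const v * fps_X ^ k * inverse ?D"
    by (simp_all only: hfrac_cons_def prod.case fps_divide_unit inverse_mult_eq_1
        one_neq_zero not_False_eq_True)
  then show ?thesis
    by (simp only: mult.assoc mult_1_right)
qed

lemma hfrac_cons_eqI:
  assumes "F * (1 + fps_of_poly u * fps_X - fps_X ^ (k + 2) * G) = fps_const v * fps_X ^ k"
  shows "hfrac_cons (v, k, u) G = F"
proof -
  let ?D = "1 + fps_of_poly u * fps_X - fps_X ^ (k + 2) * G"
  have "fps_nth ?D 0 = 1" by simp
  then have "?D \<noteq> 0" by (metis fps_zero_nth zero_neq_one)
  then show ?thesis
    using hfrac_cons_mult[of v k u G] assms by (metis mult_right_cancel)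
qed

lemma hfrac_below_nth_0: "fps_nth (hfrac_below k ds) 0 = (0 :: 'a::field)"
proof (induction ds arbitrary: k)
  case (Cons d ds)
  then show ?case by (cases d) simp
qed simp

text \<open>The exponent \<open>k\<close> from above enters only through the top numerator, where
  \<open>x^(k+l+2) = x^(k+2) x^l\<close>. This links the recursion of \<open>hfrac_below\<close> to
  \<open>hfrac_cons\<close>.\<close>

lemma hfrac_below_conv_value:
  "hfrac_below k ds = fps_X ^ (k + 2) * hfrac_value (ds :: 'a::field hlevel list)"
proof (cases ds)
  case (Cons d ds')
  obtain v l u where d: "d = (v, l, u)" by (cases d)
  have "fps_nth (1 + fps_of_poly u * fps_X - hfrac_below l ds') 0 \<noteq> 0"
    by (simp add: hfrac_below_nth_0)
  then show ?thesis
    by (simp add: Cons d fps_divide_unit power_add mult_ac)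
qed simp

lemma hfrac_value_conv_foldr: "hfrac_value ds = foldr hfrac_cons ds 0"
proof (induction ds)
  case (Cons d ds)
  obtain v k u where d: "d = (v, k, u)" by (cases d)
  show ?case
    by (simp add: d hfrac_below_conv_value hfrac_cons_def Cons.IH)
qed simp

text \<open>\<open>v x^k / D - v x^k / D' = v x^k (D' - D) / (D D')\<close>, and
  \<open>D' - D\<close> brings in another \<open>x^(k+2)\<close>; at least two orders are gained,
  uniformly in \<open>d\<close>.\<close>

lemma hfrac_cons_contracting:
  assumes "fps_X ^ m dvd G - G'"
  shows "fps_X ^ (m + 2) dvd hfrac_cons d G - hfrac_cons d G'"
proof -
  obtain v k u where d: "d = (v, k, u)" by (cases d)
  define D where "D = (\<lambda>G. 1 + fps_of_poly u * fps_X - fps_X ^ (k + 2) * G)"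
  have D0: "fps_nth (D G * D G') 0 = 1" by (simp add: D_def)
  have 1: "hfrac_cons d G * D G = fps_const v * fps_X ^ k"
    "hfrac_cons d G' * D G' = fps_const v * fps_X ^ k"
    unfolding d D_def by (rule hfrac_cons_mult)+
  have 2: "D G' - D G = fps_X ^ (k + 2) * (G - G')"
    by (simp add: D_def algebra_simps)
  have "(hfrac_cons d G - hfrac_cons d G') * (D G * D G') =
      (hfrac_cons d G * D G) * D G' - (hfrac_cons d G' * D G') * D G"
    by (simp add: algebra_simps)
  also have "\<dots> = fps_const v * fps_X ^ k * (D G' - D G)"
    unfolding 1 by (simp add: algebra_simps)
  also have "\<dots> = fps_const v * fps_X ^ (k + k) * (fps_X ^ 2 * (G - G'))"
    unfolding 2 by (simp only: power_add mult_ac)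
  finally have "(hfrac_cons d G - hfrac_cons d G') * (D G * D G') =
      fps_const v * fps_X ^ (k + k) * (fps_X ^ 2 * (G - G'))" .
  moreover have "fps_X ^ (m + 2) dvd fps_X ^ 2 * (G - G')"
    unfolding add.commute[of m] power_add using assms by (intro mult_dvd_mono dvd_refl)
  ultimately have "fps_X ^ (m + 2) dvd (hfrac_cons d G - hfrac_cons d G') * (D G * D G')"
    by (simp only: dvd_mult)
  then have "fps_X ^ (m + 2) dvd
      (hfrac_cons d G - hfrac_cons d G') * (D G * D G') * inverse (D G * D G')"
    by (rule dvd_mult2)
  moreover have "D G * D G' * inverse (D G * D G') = 1"
    using D0 by (simp add: inverse_mult_eq_1')
  ultimately show ?thesis
    by (simp only: mult.assoc mult_1_right)
qed

section \<open>Convergence of infinite H-fractions\<close>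

lemma foldr_hfrac_cons_contracting:
  "fps_X ^ (2 * length ds) dvd foldr hfrac_cons ds G - foldr hfrac_cons ds G'"
proof (induction ds)
  case (Cons d ds)
  from hfrac_cons_contracting[OF Cons.IH, of d] show ?case
    by (simp del: power_Suc)
qed simp

lemma hfrac_tails_unfold:
  assumes "\<And>j. E j = hfrac_cons (d j) (E (Suc j))" and "i \<le> j"
  shows "E i = foldr hfrac_cons (map d [i..<j]) (E j)"
  using assms(2)
proof (induction j rule: dec_induct)
  case (step n)
  then show ?case using assms(1)[of n] by simp
qed simp

text \<open>The convergent with \<open>n\<close> levels arises from \<open>E 0\<close> by replacing
  the tail \<open>E n\<close> by 0, so both agree modulo \<open>x^(2n)\<close>.\<close>

lemma is_hfraction_of_InfiniteI:
  assumes "\<And>j. valid_hlevel (d j)" and E: "\<And>j. E j = hfrac_cons (d j) (E (Suc j))"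
  shows "is_hfraction_of (Infinite d) (E 0)"
proof -
  have "eventually (\<lambda>n. fps_X ^ m dvd hfrac_value (map d [0..<n]) - E 0) sequentially" for m
  proof (rule eventually_sequentiallyI[of m])
    fix n assume "m \<le> n"
    have "E 0 = foldr hfrac_cons (map d [0..<n]) (E n)"
      using E by (rule hfrac_tails_unfold) simp
    then have "fps_X ^ (2 * n) dvd hfrac_value (map d [0..<n]) - E 0"
      using foldr_hfrac_cons_contracting[of "map d [0..<n]" 0 "E n"]
      by (simp add: hfrac_value_conv_foldr)
    moreover have "(fps_X :: 'a fps) ^ m dvd fps_X ^ (2 * n)"
      using \<open>m \<le> n\<close> by (simp add: le_imp_power_dvd)
    ultimately show "fps_X ^ m dvd hfrac_value (map d [0..<n]) - E 0"
      by (rule dvd_trans[rotated])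
  qed
  then show ?thesis using assms(1) by (simp add: tendsto_fps_iff_dvd)
qed

lemma convergent_hfrac_value: "convergent (\<lambda>n. hfrac_value (map d [0..<n]))"
proof -
  let ?c = "\<lambda>n. hfrac_value (map d [0..<n])"
  \<comment> \<open>Convergents with more than \<open>i\<close> levels share their first
    \<open>i + 1\<close> levels, so coefficient \<open>i\<close> is final from convergent
    \<open>i + 1\<close> on.\<close>
  define L where "L = Abs_fps (\<lambda>i. fps_nth (?c (Suc i)) i)"
  have eq: "fps_nth (?c n) i = fps_nth (?c (Suc i)) i" if "Suc i \<le> n" for n i
  proof -
    have "[0..<n] = [0..<Suc i] @ [Suc i..<n]"
      using upt_add_eq_append[of 0 "Suc i" "n - Suc i"] that by simp
    then have "?c n = foldr hfrac_cons (map d [0..<Suc i]) (hfrac_value (map d [Suc i..<n]))"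
      by (simp only: hfrac_value_conv_foldr map_append foldr_append)
    moreover have "?c (Suc i) = foldr hfrac_cons (map d [0..<Suc i]) 0"
      by (rule hfrac_value_conv_foldr)
    ultimately have "fps_X ^ (2 * Suc i) dvd ?c n - ?c (Suc i)"
      using foldr_hfrac_cons_contracting[of "map d [0..<Suc i]" "hfrac_value (map d [Suc i..<n])" 0]
      by (simp only: length_map length_upt diff_zero)
    then show ?thesis
      by (simp only: fps_X_power_dvd_iff) auto
  qed
  have "?c \<longlonglongrightarrow> L"
  proof (rule tendsto_fpsI)
    fix i
    show "eventually (\<lambda>n. fps_nth (?c n) i = fps_nth L i) sequentially"
      by (rule eventually_sequentiallyI[of "Suc i"]) (use eq in \<open>simp add: L_def\<close>)
  qed
  then show ?thesis by (rule convergentI)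
qed

text \<open>The tails are recovered as limits of the convergents of the shifted data, and the
  recursion survives the limit because \<open>hfrac_cons\<close> is continuous.\<close>

lemma is_hfraction_of_InfiniteE:
  assumes "is_hfraction_of (Infinite d) F"
  obtains E where "E 0 = F" and "\<And>j. E j = hfrac_cons (d j) (E (Suc j))"
proof -
  define E where "E = (\<lambda>j. lim (\<lambda>n. hfrac_value (map (\<lambda>i. d (j + i)) [0..<n])))"
  have lim: "(\<lambda>n. hfrac_value (map (\<lambda>i. d (j + i)) [0..<n])) \<longlonglongrightarrow> E j" for j
    using convergent_hfrac_value[of "\<lambda>i. d (j + i)"] by (simp add: E_def convergent_LIMSEQ_iff)
  from assms have "(\<lambda>n. hfrac_value (map d [0..<n])) \<longlonglongrightarrow> F" by simp
  with lim[of 0] have E0: "E 0 = F" by (simp add: LIMSEQ_unique)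
  have "E j = hfrac_cons (d j) (E (Suc j))" for j
  proof -
    \<comment> \<open>Starting at one level leaves a first level to split off in every
      convergent.\<close>
    have "(\<lambda>n. hfrac_value (map (\<lambda>i. d (j + i)) [0..<Suc n])) \<longlonglongrightarrow> E j"
      using lim by (rule LIMSEQ_Suc)
    also have "(\<lambda>n. hfrac_value (map (\<lambda>i. d (j + i)) [0..<Suc n])) =
        (\<lambda>n. hfrac_cons (d j) (hfrac_value (map (\<lambda>i. d (Suc j + i)) [0..<n])))"
      by (auto simp: hfrac_value_conv_foldr map_upt_Suc simp del: upt_Suc)
    finally have "(\<lambda>n. hfrac_cons (d j) (hfrac_value (map (\<lambda>i. d (Suc j + i)) [0..<n]))) \<longlonglongrightarrow> E j" .
    moreover have "(\<lambda>n. hfrac_cons (d j) (hfrac_value (map (\<lambda>i. d (Suc j + i)) [0..<n])))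
        \<longlonglongrightarrow> hfrac_cons (d j) (E (Suc j))"
      unfolding tendsto_fps_iff_dvd
    proof
      fix m
      have "eventually (\<lambda>n. fps_X ^ m dvd
          hfrac_value (map (\<lambda>i. d (Suc j + i)) [0..<n]) - E (Suc j)) sequentially"
        using lim[of "Suc j"] by (simp only: tendsto_fps_iff_dvd)
      then show "eventually (\<lambda>n. fps_X ^ m dvd
          hfrac_cons (d j) (hfrac_value (map (\<lambda>i. d (Suc j + i)) [0..<n])) -
          hfrac_cons (d j) (E (Suc j))) sequentially"
      proof eventually_elim
        case (elim n)
        from hfrac_cons_contracting[OF this] show ?case
          by (rule dvd_trans[rotated]) (simp add: le_imp_power_dvd)
      qed
    qed
    ultimately show ?thesis
      by (rule LIMSEQ_unique)
  qed
  with E0 show ?thesis by (rule that)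
qed

section \<open>Uniqueness and existence of the expansion\<close>

lemma hfrac_cons_factor:
  obtains F' where "hfrac_cons (v, k, u) G = fps_X ^ k * F'" and "fps_nth F' 0 = v"
proof
  let ?D = "1 + fps_of_poly u * fps_X - fps_X ^ (k + 2) * G"
  have "fps_nth ?D 0 = 1" by simp
  then show "hfrac_cons (v, k, u) G = fps_X ^ k * (fps_const v * inverse ?D)"
    by (simp only: hfrac_cons_def prod.case fps_divide_unit one_neq_zero not_False_eq_True mult_ac)
  show "fps_nth (fps_const v * inverse ?D) 0 = v" by simp
qed

text \<open>The series determines \<open>k\<close> as its order, \<open>v\<close> as its leading
  coefficient and thereby the denominator. There \<open>u x\<close> occupies the degrees 1 to
  \<open>k + 1\<close> and \<open>x^(k+2) G\<close> the higher ones, so the two cannot mix.\<close>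

lemma hfrac_cons_inject:
  assumes "valid_hlevel d" "valid_hlevel d'" and "hfrac_cons d G = hfrac_cons d' G'"
  shows "d = d' \<and> G = G'"
proof -
  obtain v k u where d: "d = (v, k, u)" by (cases d)
  obtain v' k' u' where d': "d' = (v', k', u')" by (cases d')
  define F where "F = hfrac_cons d G"
  obtain F1 where F1: "F = fps_X ^ k * F1" "fps_nth F1 0 = v"
    using hfrac_cons_factor[of v k u G] unfolding F_def d by blast
  obtain F2 where F2: "F = fps_X ^ k' * F2" "fps_nth F2 0 = v'"
    using hfrac_cons_factor[of v' k' u' G'] assms(3) unfolding F_def d' by metis
  have v: "v \<noteq> 0" "v' \<noteq> 0" and deg: "Polynomial.degree u \<le> k" "Polynomial.degree u' \<le> k'"
    using assms(1,2) by (auto simp: valid_hlevel_def d d')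
  have "subdegree F = k"
    using F1 v by (intro subdegreeI) (auto simp: fps_X_power_mult_nth)
  moreover have "subdegree F = k'"
    using F2 v by (intro subdegreeI) (auto simp: fps_X_power_mult_nth)
  ultimately have k: "k' = k" by simp
  have "F1 = F2" using F1(1) F2(1) k by simp
  then have v': "v' = v" using F1(2) F2(2) by simp
  have "F \<noteq> 0" using F1 v by (auto simp: fps_X_power_mult_nth)
  have "F * (1 + fps_of_poly u * fps_X - fps_X ^ (k + 2) * G) =
      F * (1 + fps_of_poly u' * fps_X - fps_X ^ (k + 2) * G')"
    using hfrac_cons_mult[of v k u G] hfrac_cons_mult[of v' k' u' G'] assms(3)
    unfolding F_def d d' k v' by simp
  then have eq: "fps_of_poly u * fps_X - fps_X ^ (k + 2) * G =
      fps_of_poly u' * fps_X - fps_X ^ (k + 2) * G'"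
    using \<open>F \<noteq> 0\<close> by (simp only: mult_cancel_left add_diff_eq[symmetric] add_left_cancel) simp
  have "Polynomial.coeff u n = Polynomial.coeff u' n" for n
  proof (cases "n \<le> k")
    case True
    then show ?thesis
      using arg_cong[OF eq, of "\<lambda>f. fps_nth f (Suc n)"]
      by (simp add: fps_X_power_mult_nth del: power_Suc power_add)
  next
    case False
    then show ?thesis using deg k by (simp add: coeff_eq_0)
  qed
  then have u: "u = u'" by (simp add: poly_eq_iff)
  then have "G = G'" using eq by simp
  then show ?thesis by (simp add: d d' k v' u)
qed

lemma hfrac_cons_exists:
  fixes F :: "'a::field fps"
  assumes "F \<noteq> 0"
  obtains d G where "valid_hlevel d" and "F = hfrac_cons d G"
proof -
  define k where "k = subdegree F"
  define v where "v = fps_nth F k"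
  \<comment> \<open>The only possible denominator, \<open>v x^k / F\<close>; \<open>u\<close> takes
    its coefficients 1 to \<open>k + 1\<close> and \<open>- G\<close> the higher ones.\<close>
  define D where "D = fps_const v * inverse (fps_shift k F)"
  define u where "u = truncate_fps (Suc k) (fps_shift 1 D)"
  define G where "G = - fps_shift (k + 2) D"
  have v: "v \<noteq> 0" using assms by (simp add: v_def k_def)
  have F: "F = fps_X ^ k * fps_shift k F"
    by (rule fps_conv_fps_X_power_mult_fps_shift) (simp add: k_def)
  have 0: "fps_nth (fps_shift k F) 0 = v" by (simp add: v_def)
  have D0: "fps_nth D 0 = 1" using v 0 by (simp add: D_def)
  have "fps_shift k F * D = fps_const v"
    using v 0 by (simp add: D_def inverse_mult_eq_1' mult.left_commute[of _ "fps_const v"])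
  then have FD: "F * D = fps_const v * fps_X ^ k"
    by (subst F) (simp add: mult.assoc mult.commute)
  have "D = 1 + fps_of_poly u * fps_X - fps_X ^ (k + 2) * G"
  proof (rule fps_ext)
    fix n
    show "fps_nth D n = fps_nth (1 + fps_of_poly u * fps_X - fps_X ^ (k + 2) * G) n"
      using D0 by (cases n) (auto simp: u_def G_def fps_X_power_mult_nth coeff_truncate_fps
          simp del: power_Suc)
  qed
  with FD have "hfrac_cons (v, k, u) G = F"
    by (intro hfrac_cons_eqI) simp
  moreover have "Polynomial.degree u \<le> k"
    using degree_truncate_fps[of "Suc k" "fps_shift 1 D"] by (simp add: u_def)
  ultimately show ?thesis
    using that[of "(v, k, u)" G] v by (simp add: valid_hlevel_def)
qed

text \<open>Levels are peeled off while the tail is nonzero. The expansion ends at the first zero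
  tail, or is infinite if there is none.\<close>

lemma hfraction_exists:
  fixes F :: "'a::field fps"
  obtains h where "is_hfraction_of h F"
proof -
  have "\<exists>d G. F \<noteq> 0 \<longrightarrow> valid_hlevel d \<and> F = hfrac_cons d G" for F :: "'a fps"
    using hfrac_cons_exists by metis
  then obtain lev tail where
    step: "\<And>F :: 'a fps. F \<noteq> 0 \<Longrightarrow> valid_hlevel (lev F) \<and> F = hfrac_cons (lev F) (tail F)"
    by metis
  define E where "E = (\<lambda>j. (tail ^^ j) F)"
  define d where "d = (\<lambda>j. lev (E j))"
  have E: "E j = hfrac_cons (d j) (E (Suc j))" "valid_hlevel (d j)" if "E j \<noteq> 0" for j
    using step[OF that] by (simp_all add: E_def d_def)
  show ?thesis
  proof (cases "\<exists>j. E j = 0")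
    case True
    define n where "n = (LEAST j. E j = 0)"
    have n: "E n = 0" using True unfolding n_def by (rule LeastI_ex)
    have less: "E j \<noteq> 0" if "j < n" for j using that not_less_Least unfolding n_def by blast
    have "E 0 = foldr hfrac_cons (map d [0..<j]) (E j)" if "j \<le> n" for j
      using that
    proof (induction j)
      case (Suc j)
      then show ?case using E(1)[OF less, of j] by simp
    qed simp
    from this[of n] have "hfrac_value (map d [0..<n]) = F"
      using n by (simp add: hfrac_value_conv_foldr E_def)
    then have "is_hfraction_of (Terminating (map d [0..<n])) F"
      using E(2) less by auto
    then show ?thesis by (rule that)
  next
    case False
    have "is_hfraction_of (Infinite d) (E 0)"
    proof (rule is_hfraction_of_InfiniteI)
      show "valid_hlevel (d j)" "E j = hfrac_cons (d j) (E (Suc j))" for j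
        using E[of j] False by blast+
    qed
    then show ?thesis
      unfolding E_def funpow_0 by (rule that)
  qed
qed

section \<open>Quadratic equations of the tails\<close>

lemma degree_monom_mult_le_cancel:
  fixes p :: "'a::field poly"
  assumes "Polynomial.degree (Polynomial.monom 1 n * p) \<le> N + n"
  shows "Polynomial.degree p \<le> N"
proof (cases "p = 0")
  case False
  then have "Polynomial.degree (Polynomial.monom 1 n * p) = n + Polynomial.degree p"
    by (simp add: degree_mult_eq degree_monom_eq monom_eq_0_iff)
  with assms show ?thesis by simp
qed simp

lemma fps_of_poly_pCons_1: "fps_of_poly (pCons (1 :: 'a::field) u) = 1 + fps_of_poly u * fps_X"
  by (simp add: fps_of_poly_pCons)

text \<open>Divisibility found among power series, where the quotient may involve \<open>F\<close>
  or \<open>G\<close>, descends to polynomials.\<close>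

lemma fps_of_poly_eq_X_power_multD:
  assumes "fps_of_poly p = fps_X ^ n * (f :: 'a::field fps)"
  obtains q where "p = Polynomial.monom 1 n * q" and "fps_of_poly q = f"
proof -
  have "Polynomial.coeff p i = 0" if "i < n" for i
    using arg_cong[OF assms, of "\<lambda>f. fps_nth f i"] that by (simp add: fps_X_power_mult_nth)
  then obtain q where q: "p = Polynomial.monom 1 n * q"
    unfolding atomize_all using monom_1_dvd_iff'[of n p] by (auto elim: dvdE)
  then have "fps_of_poly q = f"
    using assms by (simp add: fps_of_poly_mult fps_of_poly_monom')
  with q that show ?thesis by blast
qed

text \<open>Substituting \<open>F = v x\<^sup>k / (P - x\<^sup>k\<^sup>+\<^sup>2 G)\<close> into the quadratic equation of \<open>F\<close> and
  clearing denominators makes every coefficient divisible by \<open>x\<^sup>m\<^sup>+\<^sup>k\<^sup>+\<^sup>2\<close>.\<close>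

lemma quadratic_equation_tail:
  fixes F G :: "'a::field fps"
  defines "X \<equiv> Polynomial.monom 1"
  assumes eq: "fps_of_poly A + fps_of_poly B * F + fps_of_poly C * F ^ 2 = 0"
    and F: "F = hfrac_cons (v, k, u) G"
    and A': "A = X m * A'"
    and S: "2 * A * pCons 1 u + Polynomial.smult v (X k * B) = X m * S"
  obtains A'' where
    "A * pCons 1 u ^ 2 + Polynomial.smult v (X k * pCons 1 u * B) +
       Polynomial.smult (v ^ 2) (X (2 * k) * C) = X (m + k + 2) * A''"
    and "fps_of_poly A'' + fps_of_poly (- S) * G + fps_of_poly (X (k + 2) * A') * G ^ 2 = 0"
proof -
  note fps_of_poly_simps' = fps_of_poly_mult fps_of_poly_add fps_of_poly_smult fps_of_poly_power
    fps_of_poly_monom' fps_of_poly_uminus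
  define a b c s a' where "a = fps_of_poly A" "b = fps_of_poly B" "c = fps_of_poly C"
    "s = fps_of_poly S" "a' = fps_of_poly A'"
  note abc = this
  define P where "P = fps_of_poly (pCons 1 u)"
  \<comment> \<open>With the powers of \<open>x\<close> hidden behind names, the computation below
    is a sequence of ring identities in which the common factor \<open>y * x * z\<close> stays
    visible.\<close>
  define x y z V :: "'a fps"
    where "x = fps_X ^ k" "y = fps_X ^ m" "z = fps_X ^ 2" "V = fps_const v"
  note xyz = this
  have pow: "fps_X ^ (k + 2) = x * z" "fps_X ^ (2 * k) = x ^ 2" "fps_X ^ (m + k + 2) = y * x * z"
    unfolding xyz by (simp_all only: power_add power_mult[symmetric] mult.commute)
  define D where "D = P - x * z * G"
  have FD: "F * D = V * x"
    using hfrac_cons_mult[of v k u G]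
    unfolding F D_def P_def fps_of_poly_pCons_1 pow unfolding xyz .
  have a: "a = y * a'"
    unfolding abc A' X_def xyz by (simp only: fps_of_poly_simps')
  have s: "2 * a * P + V * (x * b) = y * s"
    using arg_cong[OF S, of fps_of_poly]
    by (simp only: X_def fps_of_poly_simps' abc P_def xyz fps_of_poly_numeral)
  \<comment> \<open>The factor \<open>D ^ 2\<close> clears denominators, each \<open>F\<close> being
    absorbed by one \<open>D\<close> through \<open>F * D = V * x\<close>.\<close>
  have "0 = (a + b * F + c * F ^ 2) * D ^ 2"
    using eq by (simp add: abc)
  also have "\<dots> = a * D ^ 2 + b * (F * D) * D + c * (F * D) ^ 2"
    by (simp add: algebra_simps power2_eq_square)
  also have "\<dots> = (a * P ^ 2 + V * (x * P * b) + V ^ 2 * (x ^ 2 * c))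
      - x * z * (2 * a * P + V * (x * b)) * G + a * (x * z) ^ 2 * G ^ 2"
    unfolding FD by (simp add: D_def algebra_simps power2_eq_square)
  also have "\<dots> = (a * P ^ 2 + V * (x * P * b) + V ^ 2 * (x ^ 2 * c))
      - y * x * z * (s * G - x * z * a' * G ^ 2)"
    unfolding s unfolding a by (simp add: algebra_simps power2_eq_square)
  finally have num: "a * P ^ 2 + V * (x * P * b) + V ^ 2 * (x ^ 2 * c) =
      y * x * z * (s * G - x * z * a' * G ^ 2)"
    by (metis eq_iff_diff_eq_0)
  \<comment> \<open>The quotient by \<open>x^(m+k+2)\<close> is so far only a power series; the
    left-hand side is a polynomial, so the quotient is one too.\<close>
  have "fps_of_poly (A * pCons 1 u ^ 2 + Polynomial.smult v (X k * pCons 1 u * B) +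
       Polynomial.smult (v ^ 2) (X (2 * k) * C)) =
       fps_X ^ (m + k + 2) * (s * G - fps_X ^ (k + 2) * a' * G ^ 2)"
    unfolding X_def fps_of_poly_simps' fps_const_power[symmetric] pow num[symmetric]
    unfolding abc P_def xyz ..
  then obtain A'' where 1: "A * pCons 1 u ^ 2 + Polynomial.smult v (X k * pCons 1 u * B) +
       Polynomial.smult (v ^ 2) (X (2 * k) * C) = X (m + k + 2) * A''"
    and A'': "fps_of_poly A'' = s * G - fps_X ^ (k + 2) * a' * G ^ 2"
    unfolding X_def by (rule fps_of_poly_eq_X_power_multD)
  have "fps_of_poly A'' + fps_of_poly (- S) * G + fps_of_poly (X (k + 2) * A') * G ^ 2 = 0"
    unfolding A'' by (simp add: X_def fps_of_poly_simps' abc)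
  with 1 show ?thesis by (rule that)
qed

text \<open>\<open>B(0) \<noteq> 0\<close> makes the equation nontrivial in \<open>F\<close>;
  together with \<open>C(0) = 0\<close> it makes the linear coefficient of the next equation a unit
  again. The staggered degree bounds are chosen so that they reproduce themselves.\<close>

definition quadratic_series :: "nat \<Rightarrow> 'a::field fps set" where
  "quadratic_series N = {F. \<exists>A B C.
     Polynomial.degree A \<le> N \<and> Polynomial.degree B \<le> N + 1 \<and> Polynomial.degree C \<le> N + 2 \<and>
     Polynomial.coeff B 0 \<noteq> 0 \<and> Polynomial.coeff C 0 = 0 \<and>
     fps_of_poly A + fps_of_poly B * F + fps_of_poly C * F ^ 2 = 0}"

text \<open>\<open>quadratic_equation_tail\<close> applies with \<open>m = k\<close>:
  \<open>F = x^k F'\<close> forces \<open>A = x^k A'\<close> with \<open>A'(0) = - v B(0)\<close>,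
  so \<open>S(0) = 2 A'(0) + v B(0) = - v B(0)\<close> is nonzero. The numerator and
  \<open>x^k S\<close> have degrees at most \<open>N + 2k + 2\<close> and \<open>N + 1 + k\<close>;
  dividing by \<open>x^(2k+2)\<close> and \<open>x^k\<close> restores the bounds \<open>N\<close>
  and \<open>N + 1\<close>.\<close>

lemma quadratic_series_tail:
  fixes G :: "'a::field fps"
  assumes valid: "valid_hlevel d" and mem: "hfrac_cons d G \<in> quadratic_series N"
  shows "G \<in> quadratic_series N"
proof -
  obtain v k u where d: "d = (v, k, u)" by (cases d)
  define F where "F = hfrac_cons (v, k, u) G"
  let ?X = "Polynomial.monom (1 :: 'a)" and ?P = "pCons 1 u"
  have v: "v \<noteq> 0" and deg_u: "Polynomial.degree u \<le> k"
    using valid by (auto simp: valid_hlevel_def d)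
  have deg_P: "Polynomial.degree ?P \<le> k + 1"
    using deg_u by (auto intro: order.trans[OF degree_pCons_le])
  from mem obtain A B C where
    deg: "Polynomial.degree A \<le> N" "Polynomial.degree B \<le> N + 1" "Polynomial.degree C \<le> N + 2"
    and BC: "Polynomial.coeff B 0 \<noteq> 0" "Polynomial.coeff C 0 = 0"
    and eq: "fps_of_poly A + fps_of_poly B * F + fps_of_poly C * F ^ 2 = 0"
    by (auto simp: quadratic_series_def d F_def)
  obtain F' where F': "F = fps_X ^ k * F'" "fps_nth F' 0 = v"
    unfolding F_def by (rule hfrac_cons_factor)
  have "fps_of_poly A = fps_X ^ k * (- F' * (fps_of_poly B + fps_of_poly C * F))"
    using eq unfolding F'(1)
    by (simp add: algebra_simps power2_eq_square eq_neg_iff_add_eq_0)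
  then obtain A' where A': "A = ?X k * A'"
    and "fps_of_poly A' = - F' * (fps_of_poly B + fps_of_poly C * F)"
    by (rule fps_of_poly_eq_X_power_multD)
  then have A'0: "Polynomial.coeff A' 0 = - v * Polynomial.coeff B 0"
    using BC(2) F'(2) by (metis (no_types, lifting) add.right_neutral fps_add_nth fps_mult_nth_0 fps_neg_nth fps_of_poly_nth mult_zero_left)
  define S where "S = 2 * A' * ?P + Polynomial.smult v B"
  have S: "2 * A * ?P + Polynomial.smult v (?X k * B) = ?X k * S"
    by (simp add: S_def A' algebra_simps)
  have S0: "Polynomial.coeff S 0 = - v * Polynomial.coeff B 0"
    by (simp add: S_def coeff_mult_0 A'0 numeral_poly algebra_simps)
  obtain A'' where A'':
    "A * ?P ^ 2 + Polynomial.smult v (?X k * ?P * B) +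
       Polynomial.smult (v ^ 2) (?X (2 * k) * C) = ?X (k + k + 2) * A''" (is "?num = _")
    and eqG: "fps_of_poly A'' + fps_of_poly (- S) * G + fps_of_poly (?X (k + 2) * A') * G ^ 2 = 0"
    using eq F_def A' S by (rule quadratic_equation_tail)
  have deg_X: "Polynomial.degree (?X n) \<le> n" for n by (rule degree_monom_le)
  have mult_le: "Polynomial.degree (p * q) \<le> m + n"
    if "Polynomial.degree p \<le> m" "Polynomial.degree q \<le> n" for p q :: "'a poly" and m n
    using that degree_mult_le[of p q] by linarith
  have "Polynomial.degree (?P ^ 2) \<le> 2 * k + 2"
    using mult_le[OF deg_P deg_P] by (simp add: power2_eq_square)
  then have "Polynomial.degree (A * ?P ^ 2) \<le> N + (2 * k + 2)"
    by (rule mult_le[OF deg(1)])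
  moreover have "Polynomial.degree (?X k * ?P * B) \<le> N + (2 * k + 2)"
    using mult_le[OF mult_le[OF deg_X[of k] deg_P] deg(2)] by simp
  moreover have "Polynomial.degree (?X (2 * k) * C) \<le> N + (2 * k + 2)"
    using mult_le[OF deg_X[of "2 * k"] deg(3)] by simp
  ultimately have "Polynomial.degree ?num \<le> N + (k + k + 2)"
    by (intro degree_add_le order.trans[OF degree_smult_le]) auto
  then have 1: "Polynomial.degree A'' \<le> N"
    unfolding A'' by (rule degree_monom_mult_le_cancel)
  have "Polynomial.degree (A * ?P) \<le> (N + 1) + k"
    using mult_le[OF deg(1) deg_P] by simp
  then have "Polynomial.degree (2 * A * ?P) \<le> (N + 1) + k"
    by (simp only: mult_2 distrib_right degree_add_le)
  moreover have "Polynomial.degree (?X k * B) \<le> (N + 1) + k"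
    using mult_le[OF deg_X[of k] deg(2)] by simp
  ultimately have "Polynomial.degree (?X k * S) \<le> (N + 1) + k"
    unfolding S[symmetric] by (intro degree_add_le order.trans[OF degree_smult_le]) auto
  then have 2: "Polynomial.degree (- S) \<le> N + 1"
    unfolding degree_minus by (rule degree_monom_mult_le_cancel)
  \<comment> \<open>Because \<open>m = k\<close>, the new quadratic coefficient is
    \<open>x^2 A\<close>, whatever \<open>k\<close> is.\<close>
  have "?X (k + 2) * A' = ?X 2 * A"
    by (simp add: A' mult.assoc[symmetric] mult_monom add.commute)
  then have 3: "Polynomial.degree (?X (k + 2) * A') \<le> N + 2"
    using mult_le[OF deg_X[of 2] deg(1)] by simp
  have 4: "Polynomial.coeff (- S) 0 \<noteq> 0" using S0 v BC(1) by simp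
  have 5: "Polynomial.coeff (?X (k + 2) * A') 0 = 0" by (simp add: coeff_mult_0)
  show ?thesis
    unfolding quadratic_series_def using 1 2 3 4 5 eqG by blast
qed

text \<open>There are finitely many triples of coefficients, and each gives a nonzero polynomial
  over the integral domain of power series, which has finitely many roots.\<close>

lemma finite_quadratic_series: "finite (quadratic_series N :: 'a::finite_field fps set)"
proof -
  let ?T = "{p :: 'a poly. Polynomial.degree p \<le> N + 2}"
  have "finite ?T"
  proof (rule finite_subset)
    show "?T \<subseteq> Poly ` {xs. set xs \<subseteq> UNIV \<and> length xs \<le> N + 3}"
    proof
      fix p assume "p \<in> ?T"
      then have "length (coeffs p) \<le> N + 3"
        by (cases "p = 0") (auto simp: length_coeffs_degree)
      moreover have "p = Poly (coeffs p)" by simp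
      ultimately show "p \<in> Poly ` {xs. set xs \<subseteq> UNIV \<and> length xs \<le> N + 3}"
        by blast
    qed
    show "finite (Poly ` {xs. set xs \<subseteq> (UNIV :: 'a set) \<and> length xs \<le> N + 3})"
      by (intro finite_imageI finite_lists_length_le) simp
  qed
  moreover have "finite {F. poly [:fps_of_poly A, fps_of_poly B, fps_of_poly C:] F = 0}"
    if "B \<noteq> 0" for A B C :: "'a poly"
    using that by (intro poly_roots_finite) (use fps_of_poly_eq_iff[of B 0] in simp)
  ultimately have "finite (\<Union>A\<in>?T. \<Union>B\<in>?T - {0}. \<Union>C\<in>?T.
      {F. poly [:fps_of_poly A, fps_of_poly B, fps_of_poly C:] F = 0})"
    by (intro finite_UN_I) auto
  moreover have "quadratic_series N \<subseteq> (\<Union>A\<in>?T. \<Union>B\<in>?T - {0}. \<Union>C\<in>?T.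
      {F. poly [:fps_of_poly A, fps_of_poly B, fps_of_poly C:] F = 0})"
  proof
    fix F :: "'a fps" assume "F \<in> quadratic_series N"
    then obtain A B C where
      "Polynomial.degree A \<le> N" "Polynomial.degree B \<le> N + 1" "Polynomial.degree C \<le> N + 2"
      and "Polynomial.coeff B 0 \<noteq> 0"
      and eq: "fps_of_poly A + fps_of_poly B * F + fps_of_poly C * F ^ 2 = 0"
      by (auto simp: quadratic_series_def)
    then have "A \<in> ?T" "B \<in> ?T - {0}" "C \<in> ?T" by auto
    moreover have "poly [:fps_of_poly A, fps_of_poly B, fps_of_poly C:] F = 0"
      using eq by (simp add: power2_eq_square algebra_simps)
    ultimately show "F \<in> (\<Union>A\<in>?T. \<Union>B\<in>?T - {0}. \<Union>C\<in>?T.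
      {F. poly [:fps_of_poly A, fps_of_poly B, fps_of_poly C:] F = 0})" by blast
  qed
  ultimately show ?thesis by (rule finite_subset[rotated])
qed

text \<open>The bound \<open>N\<close> can be read off from the new equation afterwards, and the
  factor \<open>x^(k+2)\<close> makes its quadratic coefficient vanish at 0; only
  \<open>S(0)\<close> has to be checked.\<close>

lemma tail_in_quadratic_seriesI:
  fixes F G :: "'a::field fps"
  assumes "fps_of_poly A + fps_of_poly B * F + fps_of_poly C * F ^ 2 = 0"
    and "F = hfrac_cons (v, k, u) G"
    and "A = Polynomial.monom 1 m * A'"
    and "2 * A * pCons 1 u + Polynomial.smult v (Polynomial.monom 1 k * B) = Polynomial.monom 1 m * S"
    and "Polynomial.coeff S 0 \<noteq> 0"
  obtains N where "G \<in> quadratic_series N"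
proof -
  obtain A'' where
    *: "fps_of_poly A'' + fps_of_poly (- S) * G + fps_of_poly (Polynomial.monom 1 (k + 2) * A') * G ^ 2 = 0"
    using assms(1-4) by (rule quadratic_equation_tail)
  let ?N = "Polynomial.degree A'' + Polynomial.degree (- S) +
    Polynomial.degree (Polynomial.monom 1 (k + 2) * A')"
  have "G \<in> quadratic_series ?N"
    unfolding quadratic_series_def mem_Collect_eq
    by (rule exI[of _ A''], rule exI[of _ "- S"], rule exI[of _ "Polynomial.monom 1 (k + 2) * A'"])
      (use * assms(5) in \<open>auto simp: coeff_mult_0\<close>)
  then show ?thesis by (rule that)
qed

section \<open>Hankel determinants\<close>

text \<open>The generating function of the left-hand side is
  \<open>D(x) D(y) (x F(x) - y F(y)) / (x - y)\<close>, which \<open>F D = v x\<^sup>k\<close> turns into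
  \<open>v (x\<^sup>k\<^sup>+\<^sup>1 D(y) - y\<^sup>k\<^sup>+\<^sup>1 D(x)) / (x - y)\<close>.\<close>

lemma hankel_double_convolution:
  fixes F D :: "'a::field fps"
  assumes FD: "F * D = fps_const v * fps_X ^ k" and D0: "fps_nth D 0 = 1"
  shows "(\<Sum>a\<le>i. \<Sum>b\<le>j. fps_nth D (i - a) * fps_nth D (j - b) * fps_nth F (a + b)) =
    v * fps_nth D (i + j - k) * (of_bool (i \<le> k \<and> k \<le> i + j) - of_bool (k < j))"
proof -
  define h where "h = (\<lambda>i j. \<Sum>a\<le>i. \<Sum>b\<le>j. fps_nth D (i - a) * fps_nth D (j - b) * fps_nth F (a + b))"
  have conv: "(\<Sum>b\<le>j. fps_nth D (j - b) * fps_nth F b) = v * of_bool (j = k)" for j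
  proof -
    have "(\<Sum>b\<le>j. fps_nth D (j - b) * fps_nth F b) = fps_nth (F * D) j"
      unfolding fps_mult_nth atLeast0AtMost by (intro sum.cong refl mult.commute)
    then show ?thesis by (simp add: FD)
  qed
  have h_sym: "h i j = h j i" for i j
    unfolding h_def by (subst sum.swap) (simp add: add.commute mult_ac)
  have h_Suc: "h (Suc i) j = v * fps_nth D (Suc i) * of_bool (j = k) +
      (\<Sum>a\<le>i. \<Sum>b\<le>j. fps_nth D (i - a) * fps_nth D (j - b) * fps_nth F (Suc (a + b)))" for i j
  proof -
    have "h (Suc i) j = (\<Sum>b\<le>j. fps_nth D (Suc i) * fps_nth D (j - b) * fps_nth F b) +
      (\<Sum>a\<le>i. \<Sum>b\<le>j. fps_nth D (i - a) * fps_nth D (j - b) * fps_nth F (Suc (a + b)))"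
      unfolding h_def by (subst sum.atMost_Suc_shift) simp
    also have "(\<Sum>b\<le>j. fps_nth D (Suc i) * fps_nth D (j - b) * fps_nth F b) =
        fps_nth D (Suc i) * (\<Sum>b\<le>j. fps_nth D (j - b) * fps_nth F b)"
      by (simp add: sum_distrib_left mult.assoc)
    finally show ?thesis unfolding conv by (simp only: mult.commute mult.left_commute)
  qed
  \<comment> \<open>\<open>h (Suc i) j\<close> and \<open>h (Suc j) i\<close> contain the same
    shifted double sum, so the symmetry of \<open>h\<close> yields a recurrence along the
    antidiagonals.\<close>
  have rec: "h (Suc i) j = h i (Suc j) + v * fps_nth D (Suc i) * of_bool (j = k)
      - v * fps_nth D (Suc j) * of_bool (i = k)" for i j
  proof -
    have "(\<Sum>a\<le>j. \<Sum>b\<le>i. fps_nth D (j - a) * fps_nth D (i - b) * fps_nth F (Suc (a + b))) =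
        (\<Sum>a\<le>i. \<Sum>b\<le>j. fps_nth D (i - a) * fps_nth D (j - b) * fps_nth F (Suc (a + b)))"
      by (subst sum.swap) (simp add: add.commute mult_ac)
    then show ?thesis
      unfolding h_sym[of i "Suc j"] h_Suc by simp
  qed
  \<comment> \<open>For \<open>i + j < k\<close> the truncated difference \<open>i + j - k\<close>
    does no harm, since both indicators are 0.\<close>
  have "h i j = v * fps_nth D (i + j - k) * (of_bool (i \<le> k \<and> k \<le> i + j) - of_bool (k < j))" for i j
  proof (induction i arbitrary: j)
    case 0
    show ?case using conv[of j] D0 by (cases "j = k") (auto simp: h_def)
  next
    case (Suc i)
    show ?case
      unfolding rec Suc.IH
      by (cases "i = k"; cases "j = k") (auto simp: of_bool_def Suc_diff_le)
  qed
  then show ?thesis by (simp add: h_def)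
qed

text \<open>The new matrix is \<open>T M T^t\<close> for the lower triangular Toeplitz matrix
  \<open>T\<close> of \<open>L\<close>, whose diagonal entries are \<open>L 0 = 1\<close>.\<close>

lemma det_mat_lower_triangular_conjugate:
  fixes f :: "nat \<Rightarrow> nat \<Rightarrow> 'a::field"
  assumes L0: "L 0 = 1"
  shows "Determinant.det (Matrix.mat n n (\<lambda>(i, j). f i j)) =
    Determinant.det (Matrix.mat n n (\<lambda>(i, j). \<Sum>a\<le>i. \<Sum>b\<le>j. L (i - a) * L (j - b) * f a b))"
proof -
  define T where "T = Matrix.mat n n (\<lambda>(i, j). if j \<le> i then L (i - j) else 0)"
  define M where "M = Matrix.mat n n (\<lambda>(i, j). f i j)"
  have carrier: "T \<in> carrier_mat n n" "M \<in> carrier_mat n n"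
    by (simp_all add: T_def M_def)
  have "Determinant.det T = prod_list (diag_mat T)"
    by (rule det_lower_triangular[OF _ carrier(1)]) (simp add: T_def)
  also have "\<dots> = 1"
    using carrier(1) L0 by (simp add: prod_list_diag_prod T_def)
  finally have det_T: "Determinant.det T = 1" .
  have restrict: "(\<Sum>a<n. if a \<le> i then g a else 0) = (\<Sum>a\<le>i. g a)" if "i < n" for i and g :: "nat \<Rightarrow> 'a"
  proof -
    have "{..<n} \<inter> {a. a \<le> i} = {..i}" using that by auto
    then show ?thesis by (simp add: sum.If_cases)
  qed
  have "T * M * transpose_mat T =
      Matrix.mat n n (\<lambda>(i, j). \<Sum>a\<le>i. \<Sum>b\<le>j. L (i - a) * L (j - b) * f a b)" (is "_ = ?R")
  proof (rule eq_matI)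
    fix i j assume "i < dim_row ?R" "j < dim_col ?R"
    then have ij: "i < n" "j < n" by auto
    have TM: "(T * M) $$ (i, b) = (\<Sum>a\<le>i. L (i - a) * f a b)" if "b < n" for b
    proof -
      have "(T * M) $$ (i, b) = (\<Sum>a<n. (if a \<le> i then L (i - a) else 0) * f a b)"
        using ij that by (simp add: T_def M_def scalar_prod_def atLeast0LessThan)
      also have "\<dots> = (\<Sum>a<n. if a \<le> i then L (i - a) * f a b else 0)"
        by (intro sum.cong) auto
      finally show ?thesis using restrict ij by simp
    qed
    have "(T * M * transpose_mat T) $$ (i, j) =
        (\<Sum>b<n. (T * M) $$ (i, b) * (if b \<le> j then L (j - b) else 0))"
      using ij carrier by (simp add: scalar_prod_def atLeast0LessThan T_def)
    also have "\<dots> = (\<Sum>b<n. if b \<le> j then (\<Sum>a\<le>i. L (i - a) * f a b) * L (j - b) else 0)"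
      by (intro sum.cong) (auto simp: TM)
    also have "\<dots> = (\<Sum>b\<le>j. (\<Sum>a\<le>i. L (i - a) * f a b) * L (j - b))"
      using restrict ij by simp
    also have "\<dots> = (\<Sum>b\<le>j. \<Sum>a\<le>i. L (i - a) * L (j - b) * f a b)"
      unfolding sum_distrib_right by (intro sum.cong refl) (simp only: mult_ac)
    also have "\<dots> = (\<Sum>a\<le>i. \<Sum>b\<le>j. L (i - a) * L (j - b) * f a b)"
      by (rule sum.swap)
    finally show "(T * M * transpose_mat T) $$ (i, j) = ?R $$ (i, j)"
      using ij by simp
  qed (use carrier in auto)
  moreover have "Determinant.det (T * M * transpose_mat T) = Determinant.det M"
    using carrier det_T by (simp add: det_mult[of _ n] det_transpose[of _ n])
  ultimately show ?thesis by (simp add: M_def)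
qed

text \<open>Conjugation by the coefficients of the denominator \<open>D\<close> leaves two diagonal
  blocks. The one of size \<open>k + 1\<close> sees only the coefficients 0 to \<open>k\<close> of
  \<open>D\<close>, hence only \<open>v\<close> and \<open>u\<close>, and its determinant is
  \<open>c\<close>. In the one of size \<open>n\<close> the minus sign of the indicator cancels that
  of \<open>- G\<close>, which gives \<open>v\<close> times the Hankel matrix of
  \<open>G\<close>.\<close>

lemma hankel_det_hfrac_cons:
  fixes v :: "'a::field"
  assumes "Polynomial.degree u \<le> k"
  obtains c where "\<And>G n. hankel_det (hfrac_cons (v, k, u) G) (n + Suc k) = c * v ^ n * hankel_det G n"
proof -
  define B1 where "B1 = Matrix.mat (Suc k) (Suc k)
    (\<lambda>(i, j). if k \<le> i + j then v * Polynomial.coeff (pCons 1 u) (i + j - k) else 0)"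
  have "hankel_det (hfrac_cons (v, k, u) G) (n + Suc k) = Determinant.det B1 * v ^ n * hankel_det G n"
    for G n
  proof -
    define D where "D = 1 + fps_of_poly u * fps_X - fps_X ^ (k + 2) * G"
    define F where "F = hfrac_cons (v, k, u) G"
    define H where "H = Matrix.mat n n (\<lambda>(i, j). fps_nth G (i + j))"
    have FD: "F * D = fps_const v * fps_X ^ k"
      unfolding F_def D_def by (rule hfrac_cons_mult)
    have D0: "fps_nth D 0 = 1" by (simp add: D_def)
    have D_low: "fps_nth D i = Polynomial.coeff (pCons 1 u) i" if "i \<le> k" for i
      using that by (cases i) (auto simp: D_def fps_X_power_mult_nth simp del: power_Suc)
    \<comment> \<open>The degree bound on \<open>u\<close> keeps \<open>u x\<close> out of the
      degrees from \<open>k + 2\<close> on.\<close>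
    have D_high: "fps_nth D (k + 2 + i) = - fps_nth G i" for i
      using assms by (simp add: D_def fps_X_power_mult_nth coeff_eq_0 del: power_Suc)
    let ?e = "\<lambda>i j. v * fps_nth D (i + j - k) * (of_bool (i \<le> k \<and> k \<le> i + j) - of_bool (k < j))"
    have "hankel_det F (n + Suc k) =
        Determinant.det (Matrix.mat (n + Suc k) (n + Suc k) (\<lambda>(i, j). ?e i j))"
      unfolding hankel_det_def
      by (subst det_mat_lower_triangular_conjugate[where L = "fps_nth D", OF D0])
        (simp only: hankel_double_convolution[OF FD D0])
    also have "Matrix.mat (n + Suc k) (n + Suc k) (\<lambda>(i, j). ?e i j) =
        four_block_mat B1 (0\<^sub>m (Suc k) n) (0\<^sub>m n (Suc k)) (v \<cdot>\<^sub>m H)" (is "?L = ?R")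
    proof (rule eq_matI)
      fix i j assume "i < dim_row ?R" "j < dim_col ?R"
      then have ij: "i < n + Suc k" "j < n + Suc k" by (auto simp: B1_def H_def)
      consider "i \<le> k" "j \<le> k" | "i \<le> k" "k < j" | "k < i" "j \<le> k" | "k < i" "k < j"
        by linarith
      then show "?L $$ (i, j) = ?R $$ (i, j)"
      proof cases
        case 4
        then obtain i' j' where i'j': "i = Suc k + i'" "j = Suc k + j'"
          by (metis Suc_leI le_Suc_ex)
        then have "i + j - k = k + 2 + (i' + j')" by simp
        then show ?thesis
          using ij 4 D_high[of "i' + j'"] i'j' by (simp add: B1_def H_def add_ac)
      qed (use ij D_low[of "i + j - k"] in \<open>auto simp: B1_def H_def\<close>)
    qed (auto simp: B1_def H_def)
    also have "Determinant.det \<dots> = Determinant.det B1 * Determinant.det (v \<cdot>\<^sub>m H)"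
      by (rule det_four_block_mat_lower_left_zero) (auto simp: B1_def H_def)
    also have "Determinant.det (v \<cdot>\<^sub>m H) = v ^ n * hankel_det G n"
      by (simp add: H_def hankel_det_def)
    finally show ?thesis by (simp add: F_def mult.assoc)
  qed
  then show ?thesis by (rule that)
qed

section \<open>Ultimate periodicity\<close>

text \<open>The exponent is the order of the multiplicative group, the same for all
  \<open>w\<close>.\<close>

lemma finite_field_power_eq_1:
  obtains q :: nat where "q > 0" and "\<And>w :: 'a::finite_field. w \<noteq> 0 \<Longrightarrow> w ^ q = 1"
proof
  have "card {0, 1 :: 'a} \<le> CARD('a)"
    by (rule card_mono) auto
  then have card: "CARD('a) \<ge> 2" by simp
  then show "CARD('a) - 1 > 0" by simp
  fix w :: 'a assume w: "w \<noteq> 0"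
  have "w * w ^ (CARD('a) - 1) = w ^ CARD('a)"
    using card by (simp add: power_eq_if)
  also have "\<dots> = w * 1"
    by (simp add: finite_field_power_card_eq_same)
  finally show "w ^ (CARD('a) - 1) = 1"
    using w by simp
qed

text \<open>\<open>w ^ n\<close> has period \<open>q\<close> and \<open>g\<close> ultimately has
  period \<open>T\<close>, so \<open>q * T\<close> serves for both.\<close>

lemma ultimately_periodic_scaled_shift:
  fixes g h :: "nat \<Rightarrow> 'a::finite_field"
  assumes h: "\<And>n. h (n + s) = c * w ^ n * g n" and w: "w \<noteq> 0" and g: "ultimately_periodic g"
  shows "ultimately_periodic h"
proof -
  obtain q where q: "q > 0" "w ^ q = 1"
    using finite_field_power_eq_1 w by metis
  obtain N T where T: "T > 0" "\<And>n. n \<ge> N \<Longrightarrow> g (n + T) = g n"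
    using g by (auto simp: ultimately_periodic_def)
  have gT: "g (n + m * T) = g n" if "n \<ge> N" for n m
  proof (induction m)
    case (Suc m)
    have "g (n + Suc m * T) = g ((n + m * T) + T)" by (simp add: add_ac)
    then show ?case using T(2)[of "n + m * T"] that Suc by simp
  qed simp
  have "h (n + q * T) = h n" if "n \<ge> N + s" for n
  proof -
    have "h (n + q * T) = h ((n - s + q * T) + s)" using that by simp
    also have "\<dots> = c * w ^ (n - s + q * T) * g (n - s + q * T)" by (rule h)
    also have "\<dots> = c * w ^ (n - s) * g (n - s)"
      using gT[of "n - s" q] that by (simp only: power_add power_mult q(2) power_one mult_1_right)
    also have "\<dots> = h ((n - s) + s)" by (rule h[symmetric])
    finally show ?thesis using that by simp
  qed
  moreover have "q * T > 0" using q(1) T(1) by simp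
  ultimately show ?thesis unfolding ultimately_periodic_def by blast
qed

text \<open>After \<open>q\<close> shifts the factor no longer depends on \<open>n\<close>, since
  \<open>(w ^ n) ^ q = 1\<close>, and a constant \<open>K\<close> is left. Repeating this
  \<open>q\<close> times gives \<open>K ^ q = 1\<close>, unless \<open>K = 0\<close>, in which case
  \<open>h\<close> vanishes from \<open>q * s\<close> on.\<close>

lemma ultimately_periodic_scaled_self_shift:
  fixes h :: "nat \<Rightarrow> 'a::finite_field"
  assumes h: "\<And>n. h (n + s) = c * w ^ n * h n" and w: "w \<noteq> 0" and s: "s > 0"
  shows "ultimately_periodic h"
proof -
  obtain q where q: "q > 0" "\<And>x :: 'a. x \<noteq> 0 \<Longrightarrow> x ^ q = 1"
    using finite_field_power_eq_1 by metis
  have "\<exists>K. \<forall>n. h (n + m * s) = K * (w ^ n) ^ m * h n" for m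
  proof (induction m)
    case 0
    show ?case by (rule exI[of _ 1]) simp
  next
    case (Suc m)
    then obtain K where K: "\<And>n. h (n + m * s) = K * (w ^ n) ^ m * h n" by blast
    have "h (n + Suc m * s) = (c * w ^ (m * s) * K) * (w ^ n) ^ Suc m * h n" for n
    proof -
      have "h (n + Suc m * s) = h ((n + m * s) + s)" by (simp add: add_ac)
      also have "\<dots> = c * w ^ (n + m * s) * h (n + m * s)" by (rule h)
      finally show ?thesis by (simp add: K power_add mult_ac)
    qed
    then show ?case by blast
  qed
  then obtain K where "\<And>n. h (n + q * s) = K * (w ^ n) ^ q * h n" by blast
  then have K: "h (n + q * s) = K * h n" for n
    using q(2)[of "w ^ n"] w by simp
  have Km: "h (n + m * (q * s)) = K ^ m * h n" for n m
  proof (induction m)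
    case (Suc m)
    have "h (n + Suc m * (q * s)) = h ((n + m * (q * s)) + q * s)" by (simp add: add_ac)
    then show ?case by (simp add: K Suc)
  qed simp
  have "h (n + q * (q * s)) = h n" if "n \<ge> q * s" for n
  proof (cases "K = 0")
    case True
    have "h n = h ((n - q * s) + q * s)" using that by simp
    also have "\<dots> = 0" by (simp only: K True mult_zero_left)
    finally show ?thesis using True q(1) by (simp add: Km)
  next
    case False
    then show ?thesis by (simp add: Km q(2))
  qed
  moreover have "q * (q * s) > 0" using q(1) s by simp
  ultimately show ?thesis unfolding ultimately_periodic_def by blast
qed

text \<open>Each level uses up \<open>k + 1 \<ge> 1\<close> rows and contributes its
  \<open>v\<close> to \<open>w\<close>. The lower bound on \<open>s\<close> ensures that a nonempty
  block of levels shifts by a positive amount.\<close>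

lemma hankel_det_foldr_hfrac_cons:
  fixes ds :: "'a::field hlevel list"
  assumes "\<forall>d\<in>set ds. valid_hlevel d"
  obtains c w s where "w \<noteq> 0" and "length ds \<le> s"
    and "\<And>G n. hankel_det (foldr hfrac_cons ds G) (n + s) = c * w ^ n * hankel_det G n"
proof -
  have "\<exists>c w s. w \<noteq> 0 \<and> length ds \<le> s \<and>
      (\<forall>G n. hankel_det (foldr hfrac_cons ds G) (n + s) = c * w ^ n * hankel_det G n)"
    using assms
  proof (induction ds)
    case Nil
    show ?case by (rule exI[of _ 1], rule exI[of _ 1], rule exI[of _ 0]) simp
  next
    case (Cons d ds)
    obtain v k u where d: "d = (v, k, u)" by (cases d)
    from Cons.prems have v: "v \<noteq> 0" "Polynomial.degree u \<le> k"
      by (auto simp: valid_hlevel_def d)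
    obtain b where b: "\<And>G n. hankel_det (hfrac_cons (v, k, u) G) (n + Suc k) = b * v ^ n * hankel_det G n"
      using hankel_det_hfrac_cons[OF v(2)] by metis
    obtain c w s where w: "w \<noteq> 0" "length ds \<le> s"
      and c: "\<And>G n. hankel_det (foldr hfrac_cons ds G) (n + s) = c * w ^ n * hankel_det G n"
      using Cons by auto
    have "hankel_det (foldr hfrac_cons (d # ds) G) (n + (s + Suc k)) =
        (b * v ^ s * c) * (v * w) ^ n * hankel_det G n" for G n
    proof -
      have "hankel_det (foldr hfrac_cons (d # ds) G) (n + (s + Suc k)) =
          hankel_det (hfrac_cons (v, k, u) (foldr hfrac_cons ds G)) ((n + s) + Suc k)"
        by (simp add: d add_ac)
      also have "\<dots> = b * v ^ (n + s) * (c * w ^ n * hankel_det G n)"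
        unfolding b c ..
      finally show ?thesis by (simp add: power_add power_mult_distrib mult_ac)
    qed
    moreover have "v * w \<noteq> 0" "length (d # ds) \<le> s + Suc k" using v w by auto
    ultimately show ?case by blast
  qed
  then show ?thesis using that by blast
qed

lemma ultimately_periodic_hankel_det_foldr:
  fixes ds :: "'a::finite_field hlevel list"
  assumes "\<forall>d\<in>set ds. valid_hlevel d" and "ultimately_periodic (hankel_det G)"
  shows "ultimately_periodic (hankel_det (foldr hfrac_cons ds G))"
proof -
  obtain c w s where w: "w \<noteq> 0"
    and c: "\<And>H n. hankel_det (foldr hfrac_cons ds H) (n + s) = c * w ^ n * hankel_det H n"
    using hankel_det_foldr_hfrac_cons[OF assms(1)] by metis
  show ?thesis by (rule ultimately_periodic_scaled_shift[OF c w assms(2)])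
qed

lemma ultimately_periodic_hankel_det_loop:
  fixes ds :: "'a::finite_field hlevel list"
  assumes "\<forall>d\<in>set ds. valid_hlevel d" and "ds \<noteq> []" and "G = foldr hfrac_cons ds G"
  shows "ultimately_periodic (hankel_det G)"
proof -
  obtain c w s where "w \<noteq> 0" "length ds \<le> s"
    and "\<And>H n. hankel_det (foldr hfrac_cons ds H) (n + s) = c * w ^ n * hankel_det H n"
    using hankel_det_foldr_hfrac_cons[OF assms(1)] by metis
  moreover from this(3)[of G] have "hankel_det G (n + s) = c * w ^ n * hankel_det G n" for n
    unfolding assms(3)[symmetric] .
  moreover have "s > 0" using \<open>length ds \<le> s\<close> assms(2) by (cases ds) auto
  ultimately show ?thesis using ultimately_periodic_scaled_self_shift by blast
qed

lemma hankel_det_0: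
  assumes "n > 0"
  shows "hankel_det 0 n = (0 :: 'a::field)"
proof -
  have "Matrix.mat n n (\<lambda>(i, j). fps_nth 0 (i + j)) = (0 :: 'a) \<cdot>\<^sub>m 1\<^sub>m n"
    by (rule eq_matI) auto
  then show ?thesis using assms by (simp add: hankel_det_def)
qed

text \<open>By \<open>hfrac_cons_inject\<close> equal tails have equal levels and equal next tails,
  so one coincidence propagates and \<open>j - i\<close> is a period.\<close>

lemma hfrac_tails_ultimately_periodic:
  assumes valid: "\<And>j. valid_hlevel (d j)" and E: "\<And>j. E j = hfrac_cons (d j) (E (Suc j))"
    and ij: "i < j" "E i = E j"
  shows "ultimately_periodic d"
proof -
  have "d (i + n) = d (j + n) \<and> E (i + n) = E (j + n)" for n
  proof (induction n)
    case 0
    show ?case using hfrac_cons_inject[of "d i" "d j" "E (Suc i)" "E (Suc j)"] valid E[of i] E[of j] ij(2)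
      by simp
  next
    case (Suc n)
    have "E (Suc (i + n)) = E (Suc (j + n))"
      using hfrac_cons_inject[of "d (i + n)" "d (j + n)" "E (Suc (i + n))" "E (Suc (j + n))"]
        valid E[of "i + n"] E[of "j + n"] Suc by simp
    then show ?case
      using hfrac_cons_inject[of "d (Suc (i + n))" "d (Suc (j + n))"
          "E (Suc (Suc (i + n)))" "E (Suc (Suc (j + n)))"]
        valid E[of "Suc (i + n)"] E[of "Suc (j + n)"] by simp
  qed
  then have "d (n + (j - i)) = d n" if "n \<ge> i" for n
    using that ij(1) by (metis add.commute add_diff_inverse_nat diff_add_assoc less_imp_le not_le le_add_diff_inverse)
  then show ?thesis
    unfolding ultimately_periodic_def using ij(1) by (metis zero_less_diff)
qed

section \<open>The first tail and the conclusion\<close>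

text \<open>The power \<open>x^m\<close> to divide by depends on the case: \<open>m = k\<close> with
  \<open>S(0) = - v\<close> in \<open>simple\<close>, \<open>m = k = 0\<close> with
  \<open>S(0) = v\<close> in \<open>unit\<close>, and \<open>m = 2k\<close> with
  \<open>S(0) = - 2 v^2\<close> in \<open>root\<close>.\<close>

lemma quadratic_first_tail:
  fixes F G :: "'a::field fps"
  assumes eq: "fps_of_poly A + fps_of_poly B * F + fps_of_poly C * F ^ 2 = 0"
    and conds: "(Polynomial.coeff B 0 = 1 \<and> (Polynomial.coeff C 0 = 0 \<or> Polynomial.coeff A 0 = 0)) \<or>
      (B = 0 \<and> Polynomial.coeff C 0 = 1 \<and> (2 :: 'a) \<noteq> 0)"
    and d: "valid_hlevel d" and F: "F = hfrac_cons d G"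
  obtains N where "G \<in> quadratic_series N"
proof -
  obtain v k u where [simp]: "d = (v, k, u)" by (cases d)
  have v: "v \<noteq> 0" using d by (auto simp: valid_hlevel_def)
  have F': "F = hfrac_cons (v, k, u) G" using F by simp
  obtain f where f: "F = fps_X ^ k * f" "fps_nth f 0 = v"
    unfolding F' by (rule hfrac_cons_factor)
  have two: "Polynomial.coeff (2 * p * pCons 1 u) 0 = 2 * Polynomial.coeff p 0" for p :: "'a poly"
    by (simp add: coeff_mult_0 numeral_poly)
  note tail = tail_in_quadratic_seriesI[OF eq F' _ _ _ that]
  \<comment> \<open>If \<open>C(0) \<noteq> 0\<close> and \<open>A(0) = 0\<close>, then
    \<open>F(0)\<close> may be either root of the equation at \<open>x = 0\<close>. The root 0
    behaves like \<open>C(0) = 0\<close>, and the other one forces \<open>k = 0\<close>.\<close>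
  from conds consider
    (simple) "Polynomial.coeff B 0 = 1" "Polynomial.coeff C 0 * fps_nth F 0 = 0"
    | (unit) "Polynomial.coeff B 0 = 1" "Polynomial.coeff A 0 = 0" "fps_nth F 0 \<noteq> 0"
    | (root) "B = 0" "Polynomial.coeff C 0 = 1" "(2 :: 'a) \<noteq> 0"
    by fastforce
  then show ?thesis
  proof cases
    case simple
    have "fps_of_poly A = fps_X ^ k * (- f * (fps_of_poly B + fps_of_poly C * F))"
      using eq unfolding f(1)
      by (simp add: algebra_simps power2_eq_square eq_neg_iff_add_eq_0)
    then obtain A' where A': "A = Polynomial.monom 1 k * A'"
      and f': "fps_of_poly A' = - f * (fps_of_poly B + fps_of_poly C * F)"
      by (rule fps_of_poly_eq_X_power_multD)
    from arg_cong[OF f', of "\<lambda>g. fps_nth g 0"] have A'0: "Polynomial.coeff A' 0 = - v"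
      using simple f(2) by simp
    define S where "S = 2 * A' * pCons 1 u + Polynomial.smult v B"
    have "Polynomial.coeff S 0 = - v"
      unfolding S_def Polynomial.coeff_add two by (simp add: A'0 simple)
    moreover have "2 * A * pCons 1 u + Polynomial.smult v (Polynomial.monom 1 k * B) =
        Polynomial.monom 1 k * S"
      by (simp add: S_def A' algebra_simps)
    ultimately show ?thesis using A' v by (intro tail[of k A' S]) simp_all
  next
    case unit
    then have k: "k = 0" using f by (auto simp: fps_X_power_mult_nth split: if_splits)
    define S where "S = 2 * A * pCons 1 u + Polynomial.smult v B"
    have "Polynomial.coeff S 0 = v"
      unfolding S_def Polynomial.coeff_add two by (simp add: unit)
    moreover have "2 * A * pCons 1 u + Polynomial.smult v (Polynomial.monom 1 k * B) =
        Polynomial.monom 1 0 * S"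
      by (simp add: S_def k)
    ultimately show ?thesis using v by (intro tail[of 0 A S]) simp_all
  next
    case root
    have "fps_of_poly A = fps_X ^ (2 * k) * (- (fps_of_poly C * f ^ 2))"
      using eq root(1) unfolding f(1)
      by (simp add: power_mult_distrib power_mult[symmetric] mult_ac eq_neg_iff_add_eq_0)
    then obtain A' where A': "A = Polynomial.monom 1 (2 * k) * A'"
      and f': "fps_of_poly A' = - (fps_of_poly C * f ^ 2)"
      by (rule fps_of_poly_eq_X_power_multD)
    from arg_cong[OF f', of "\<lambda>g. fps_nth g 0"] have A'0: "Polynomial.coeff A' 0 = - (v ^ 2)"
      using root f(2) by (simp add: power2_eq_square)
    define S where "S = 2 * A' * pCons 1 u"
    have "Polynomial.coeff S 0 = - 2 * v ^ 2"
      unfolding S_def two by (simp add: A'0)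
    moreover have "2 * A * pCons 1 u + Polynomial.smult v (Polynomial.monom 1 k * B) =
        Polynomial.monom 1 (2 * k) * S"
      by (simp add: S_def A' root(1) algebra_simps)
    ultimately show ?thesis using A' v root(3) by (intro tail[of "2 * k" A' S]) simp_all
  qed
qed

lemma two_neq_0_mod_ring:
  assumes "CARD('p::prime_card) \<noteq> 2"
  shows "(2 :: 'p mod_ring) \<noteq> 0"
proof
  assume "(2 :: 'p mod_ring) = 0"
  then have "of_nat 2 = (0 :: 'p mod_ring)" by simp
  then have "CARD('p) dvd 2" by (rule of_nat_0_mod_ring_dvd)
  moreover have "prime CARD('p)" by (rule prime_card)
  ultimately show False
    using assms by (metis two_is_prime_nat primes_dvd_imp_eq)
qed

theorem theorem1p1:
  fixes F :: "'p::prime_card mod_ring fps"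
    and A B C :: "'p mod_ring poly"
  assumes eq: "fps_of_poly A + fps_of_poly B * F + fps_of_poly C * F ^ 2 = 0"
    and conds:
      "(poly B 0 = 1 \<and> poly C 0 = 0 \<and> C \<noteq> 0) \<or>
       (poly B 0 = 1 \<and> C = 0) \<or>
       (poly B 0 = 1 \<and> poly C 0 \<noteq> 0 \<and> poly A 0 = 0) \<or>
       (CARD('p) \<noteq> 2 \<and> B = 0 \<and> poly C 0 = 1 \<and>
         (\<exists>k a. a \<noteq> 0 \<and>
           Polynomial.monom 1 (2 * k + 1) dvd A - (- ((Polynomial.monom a k) ^ 2))))"
  shows "(\<exists>h. is_hfraction_of h F) \<and>
         (\<forall>h. is_hfraction_of h F \<longrightarrow> hfraction_ultimately_periodic h) \<and>
         ultimately_periodic (hankel_det F)"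
proof -
  \<comment> \<open>Cases (i) and (ii) both give \<open>C(0) = 0\<close>, case (iii) gives
    \<open>A(0) = 0\<close>, and case (iv) is the second alternative.\<close>
  have conds': "(Polynomial.coeff B 0 = 1 \<and> (Polynomial.coeff C 0 = 0 \<or> Polynomial.coeff A 0 = 0)) \<or>
      (B = 0 \<and> Polynomial.coeff C 0 = 1 \<and> (2 :: 'p mod_ring) \<noteq> 0)"
    using conds two_neq_0_mod_ring[where 'p = 'p] by (auto simp: poly_0_coeff_0)
  have periodic: "ultimately_periodic d \<and> ultimately_periodic (hankel_det F)"
    if h: "is_hfraction_of (Infinite d) F" for d
  proof -
    from h have valid: "valid_hlevel (d j)" for j by simp
    obtain E where E0: "E 0 = F" and E: "\<And>j. E j = hfrac_cons (d j) (E (Suc j))"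
      using h by (rule is_hfraction_of_InfiniteE) blast
    \<comment> \<open>The start is \<open>E 1\<close> and not \<open>E 0\<close>, since the given
      equation of \<open>F\<close> may violate \<open>B(0) \<noteq> 0\<close> or
      \<open>C(0) = 0\<close>.\<close>
    obtain N where N: "E 1 \<in> quadratic_series N"
      using quadratic_first_tail[OF eq conds' valid[of 0], of "E 1"] E[of 0] E0 by auto
    have "E (Suc j) \<in> quadratic_series N" for j
    proof (induction j)
      case 0
      then show ?case using N by simp
    next
      case (Suc j)
      then show ?case using quadratic_series_tail[OF valid] E[of "Suc j"] by metis
    qed
    then have "finite (range (\<lambda>j. E (Suc j)))"
      by (intro finite_subset[OF _ finite_quadratic_series[of N]]) auto
    then have "\<not> inj (\<lambda>j. E (Suc j))"
      using finite_imageD infinite_UNIV_nat by blast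
    then obtain a b where "a \<noteq> b" "E (Suc a) = E (Suc b)"
      by (auto simp: inj_def)
    then obtain i j where ij: "i < j" "E i = E j"
      by (cases a b rule: linorder_cases) (auto intro: that[of "Suc a" "Suc b"] that[of "Suc b" "Suc a"])
    \<comment> \<open>The levels from \<open>i\<close> to \<open>j - 1\<close> carry the tail
      \<open>E i\<close> to itself.\<close>
    have "E i = foldr hfrac_cons (map d [i..<j]) (E i)"
      using hfrac_tails_unfold[of E d i j, OF E] ij by simp
    then have "ultimately_periodic (hankel_det (E i))"
      using valid ij(1) by (intro ultimately_periodic_hankel_det_loop[of "map d [i..<j]"]) auto
    then have "ultimately_periodic (hankel_det (foldr hfrac_cons (map d [0..<i]) (E i)))"
      using valid by (intro ultimately_periodic_hankel_det_foldr) auto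
    also have "foldr hfrac_cons (map d [0..<i]) (E i) = F"
      using hfrac_tails_unfold[of E d 0 i, OF E] E0 by simp
    finally show ?thesis
      using hfrac_tails_ultimately_periodic[of d E, OF valid E ij] by simp
  qed
  obtain h where h: "is_hfraction_of h F" by (rule hfraction_exists)
  have "ultimately_periodic (hankel_det F)"
  proof (cases h)
    case (Terminating ds)
    \<comment> \<open>Constant from index 1 on only, as the Hankel determinant of order 0 is
      1.\<close>
    have "ultimately_periodic (hankel_det (0 :: 'p mod_ring fps))"
      unfolding ultimately_periodic_def
      by (rule exI[of _ 1], rule exI[of _ 1]) (simp add: hankel_det_0)
    then have "ultimately_periodic (hankel_det (foldr hfrac_cons ds (0 :: 'p mod_ring fps)))"
      using h Terminating by (intro ultimately_periodic_hankel_det_foldr) auto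
    then show ?thesis
      using h Terminating by (simp add: hfrac_value_conv_foldr)
  next
    case (Infinite d)
    then show ?thesis using h periodic by blast
  qed
  moreover have "hfraction_ultimately_periodic h'" if "is_hfraction_of h' F" for h'
    using that periodic by (cases h') auto
  ultimately show ?thesis using h by blast
qed

end
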